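(* Let $\boldsymbol{s}\in\mathbb{Z}_{\geq1}^n$ and let $r=\max\{\operatorname{asc}(\boldsymbol{e}) : \boldsymbol{e}\in\mathbf{I}_n^{(\boldsymbol{s})}\}$. Then the $\boldsymbol{s}$-lecture hall polytope $\mathbf{P}_n^{(\boldsymbol{s})}$ is Gorenstein if and only if both of the following hold: (1) for any $\boldsymbol{e}\in\mathbf{I}_{n,k}^{(\boldsymbol{s})}$ with $1\leq k<r$ there exists some $\boldsymbol{e}'\in\mathbf{I}_{n,1}^{(\boldsymbol{s})}$ such that $\boldsymbol{e}+\boldsymbol{e}'\in\mathbf{I}_{n,k+1}^{(\boldsymbol{s})}$; and (2) $|\mathbf{I}_{n,r}^{(\boldsymbol{s})}|=1$.
   Context: For $\boldsymbol{s}=(s_1,\ldots,s_n)\in\mathbb{Z}_{\ge1}^n$, the $\boldsymbol{s}$-lecture hall polytope is $$\mathbf{P}_n^{(\boldsymbol{s})}=\left\{\boldsymbol{\lambda}\in\mathbb{R}^n : 0\leq\frac{\lambda_1}{s_1}\leq\cdots\leq\frac{\lambda_n}{s_n}\leq 1\right\},$$ a lattice simplex. Inversion sequences: $\mathbf{I}_n^{(\boldsymbol{s})}=\{\boldsymbol{e}\in\mathbb{Z}_{\ge0}^n : 0\leq e_i<s_i\}$. With conventions $s_0=1$, $e_0=0$, the ascent set of $\boldsymbol{e}$ is $\operatorname{Asc}(\boldsymbol{e})=\{i\in\{0,1,\ldots,n-1\} : \frac{e_i}{s_i}<\frac{e_{i+1}}{s_{i+1}}\}$, $\operatorname{asc}(\boldsymbol{e})=\#\operatorname{Asc}(\boldsymbol{e})$,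 and $\mathbf{I}_{n,k}^{(\boldsymbol{s})}=\{\boldsymbol{e}\in\mathbf{I}_n^{(\boldsymbol{s})} : \operatorname{asc}(\boldsymbol{e})=k\}$. For $\boldsymbol{e},\boldsymbol{e}'\in\mathbf{I}_n^{(\boldsymbol{s})}$, $\boldsymbol{e}+\boldsymbol{e}'$ denotes the inversion sequence whose $i$th entry is $(e_i+e_i')\bmod s_i\in\{0,\ldots,s_i-1\}$. For a lattice polytope $P\subset\mathbb{R}^n$ with vertex set $V(P)$, $\mathrm{cone}(P)=\mathrm{span}_{\mathbb{R}_{\ge0}}\{(\boldsymbol{v},1):\boldsymbol{v}\in V(P)\}\subset\mathbb{R}^{n+1}$, with relative interior $\mathrm{cone}(P)^\circ$. $P$ is Gorenstein if its semigroup algebra $k[\mathrm{cone}(P)\cap\mathbb{Z}^{n+1}]$ is Gorenstein ($k$ an algebraically closed field of characteristic zero); equivalently, there exists $\boldsymbol{g}\in\mathbb{Z}^{n+1}$ with $\boldsymbol{g}+(\mathrm{cone}(P)\cap\mathbb{Z}^{n+1})=\mathrm{cone}(P)^\circ\cap\mathbb{Z}^{n+1}$. *)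

theory Defs
  imports "HOL-Analysis.Analysis"
begin

section \<open>Indexing the coordinates by \<open>1, ..., n\<close>\<close>

text \<open>
  Vectors of length \<open>n = CARD('n)\<close> are indexed by a finite linearly ordered type \<open>'n\<close>. For
  \<open>i \<in> {1..n}\<close>, the \<open>i\<close>-th coordinate is the one at the \<open>i\<close>-th smallest element of \<open>'n\<close>.
\<close>

definition coord :: "nat \<Rightarrow> 'n::{finite,linorder}" where
  "coord i = sorted_list_of_set (UNIV :: 'n set) ! (i - 1)"

lemma bij_betw_coord: "bij_betw (coord :: nat \<Rightarrow> 'n::{finite,linorder}) {1..CARD('n)} UNIV"
proof -
  let ?l = "sorted_list_of_set (UNIV :: 'n set)"
  have "bij_betw ((!) ?l) {..<CARD('n)} UNIV"
    by (rule bij_betw_nth) auto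
  moreover have "bij_betw (\<lambda>i. i - 1) {1..CARD('n)} {..<CARD('n)}"
    by (rule bij_betw_byWitness[where f' = Suc]) auto
  ultimately have "bij_betw ((!) ?l \<circ> (\<lambda>i. i - 1)) {1..CARD('n)} UNIV"
    by (rule bij_betw_trans[rotated])
  then show ?thesis
    by (simp add: coord_def[abs_def] comp_def)
qed

lemma strict_mono_on_coord:
  "strict_mono_on {1..CARD('n)} (coord :: nat \<Rightarrow> 'n::{finite,linorder})"
proof (rule strict_mono_onI)
  fix i j assume "i \<in> {1..CARD('n)}" "j \<in> {1..CARD('n)}" "i < j"
  then show "(coord i :: 'n) < coord j"
    unfolding coord_def
    by (intro sorted_wrt_nth_less[OF strict_sorted_list_of_set]) auto
qed


section \<open>Lecture hall polytopes and inversion sequences\<close>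

definition lecture_hall_polytope :: "nat ^ 'n::{finite,linorder} \<Rightarrow> (real ^ 'n::{finite,linorder}) set" where
  "lecture_hall_polytope s = {x.
     0 \<le> x $ coord 1 / real (s $ coord 1) \<and>
     (\<forall>i\<in>{1..<CARD('n)}.
        x $ coord i / real (s $ coord i) \<le> x $ coord (i + 1) / real (s $ coord (i + 1))) \<and>
     x $ coord CARD('n) / real (s $ coord CARD('n)) \<le> 1}"

definition inv_seqs :: "nat ^ 'n::finite \<Rightarrow> (nat ^ 'n) set" where
  "inv_seqs s = {e. \<forall>i. e $ i < s $ i}"

text \<open>The quotient \<open>e\<^sub>i / s\<^sub>i\<close>, with the conventions \<open>e\<^sub>0 = 0\<close> and \<open>s\<^sub>0 = 1\<close>.\<close>

definition ratio :: "nat ^ 'n::{finite,linorder} \<Rightarrow> nat ^ 'n::{finite,linorder} \<Rightarrow> nat \<Rightarrow> real" where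
  "ratio s e i = (if i = 0 then 0 / 1 else real (e $ coord i) / real (s $ coord i))"

definition Asc :: "nat ^ 'n::{finite,linorder} \<Rightarrow> nat ^ 'n::{finite,linorder} \<Rightarrow> nat set" where
  "Asc s e = {i \<in> {0..<CARD('n)}. ratio s e i < ratio s e (i + 1)}"

definition asc :: "nat ^ 'n::{finite,linorder} \<Rightarrow> nat ^ 'n::{finite,linorder} \<Rightarrow> nat" where
  "asc s e = card (Asc s e)"

definition inv_seqs_asc :: "nat ^ 'n::{finite,linorder} \<Rightarrow> nat \<Rightarrow> (nat ^ 'n::{finite,linorder}) set" where
  "inv_seqs_asc s k = {e \<in> inv_seqs s. asc s e = k}"

definition inv_add :: "nat ^ 'n::finite \<Rightarrow> nat ^ 'n \<Rightarrow> nat ^ 'n \<Rightarrow> nat ^ 'n" where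
  "inv_add s e e' = (\<chi> i. (e $ i + e' $ i) mod s $ i)"


section \<open>Gorenstein lattice polytopes\<close>

text \<open>The ambient space of the cone over a polytope in \<open>real ^ 'n\<close> is \<open>(real ^ 'n) \<times> real\<close>.\<close>

definition int_points :: "((real ^ 'n::finite) \<times> real) set" where
  "int_points = {(x, t). (\<forall>i. x $ i \<in> \<int>) \<and> t \<in> \<int>}"

text \<open>\<open>convex_cone hull V\<close> is the set of all finite nonnegative real combinations of \<open>V\<close>.\<close>

definition polytope_cone :: "(real ^ 'n::finite) set \<Rightarrow> ((real ^ 'n) \<times> real) set" where
  "polytope_cone P = convex_cone hull ((\<lambda>v. (v, 1)) ` {v. v extreme_point_of P})"

text \<open>
  The lattice-point description of the Gorenstein property: the semigroup algebra of
  \<open>polytope_cone P \<inter> int_points\<close> is Gorenstein iff its canonical module, which is spanned by the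
  lattice points in the relative interior of the cone, is principal. The notion is meant for
  lattice polytopes \<open>P\<close> only.
\<close>

definition gorenstein_polytope :: "(real ^ 'n::finite) set \<Rightarrow> bool" where
  "gorenstein_polytope P \<longleftrightarrow>
     (\<exists>g \<in> int_points.
        (+) g ` (polytope_cone P \<inter> int_points) = rel_interior (polytope_cone P) \<inter> int_points)"

end

theory Submission
  imports Defs
begin

text \<open>
  The classes of lattice points modulo the lifted vertices form the group \<open>\<Prod>\<^sub>i \<int>/s\<^sub>i\<close>, that is, the
  inversion sequences under \<open>inv_add\<close>. The representative of \<open>-e\<close> in the half-open fundamental
  parallelepiped of the simplicial cone has height \<open>asc e\<close>. The polytope is Gorenstein iff some
  representative \<open>m\<close> dominates all others coefficientwise: the generator \<open>g\<close> of the interior is then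
  the all-ones vector minus \<open>m\<close>. Under addition of classes, heights add iff no coefficient carries.
  Hence climbing one ascent at a time to a unique maximum forces domination. Conversely, the
  difference between \<open>m\<close> and \<open>e\<close> is a representative of height \<open>asc m - asc e\<close>, and the integer
  decomposition property supplies an element of height one below it.
\<close>

section \<open>The cone over a lecture hall polytope\<close>

text \<open>
  The \<open>n + 1\<close> increments of the chain \<open>0, x\<^sub>1 / s\<^sub>1, \<dots>, x\<^sub>n / s\<^sub>n, t\<close> are the coefficients of \<open>(x, t)\<close>
  with respect to the lifted vertices of the simplex.
\<close>

definition chain :: "nat ^ 'n::{finite,linorder} \<Rightarrow> (real ^ 'n::{finite,linorder}) \<times> real \<Rightarrow> nat \<Rightarrow> real" where
  "chain s p i = (if i = 0 then 0
     else if i \<le> CARD('n) then fst p $ coord i / real (s $ coord i) else snd p)"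

text \<open>Facet description of the simplicial cone over the polytope; the index
  \<open>CARD('n)\<close> gives the inequality against the height.\<close>

definition chain_cone :: "nat ^ 'n::{finite,linorder} \<Rightarrow> ((real ^ 'n::{finite,linorder}) \<times> real) set" where
  "chain_cone s = {p. \<forall>i\<le>CARD('n). chain s p i \<le> chain s p (Suc i)}"

definition chain_open_cone :: "nat ^ 'n::{finite,linorder} \<Rightarrow> ((real ^ 'n::{finite,linorder}) \<times> real) set" where
  "chain_open_cone s = {p. \<forall>i\<le>CARD('n). chain s p i < chain s p (Suc i)}"

lemma chain_add: "chain s (p + q) i = chain s p i + chain s q i"
  by (simp add: chain_def add_divide_distrib)

lemma chain_diff: "chain s (p - q) i = chain s p i - chain s q i"
  by (simp add: chain_def diff_divide_distrib)

lemma chain_scaleR: "chain s (c *\<^sub>R p) i = c * chain s p i"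
  by (simp add: chain_def)

lemma chain_zero [simp]: "chain s 0 i = 0"
  by (simp add: chain_def)

lemma continuous_on_chain [continuous_intros]:
  fixes s :: "nat ^ 'n::{finite,linorder}"
  shows "continuous_on A (\<lambda>p. chain s p i)"
proof -
  have "continuous_on A (\<lambda>p. fst p $ coord i / real (s $ coord i))"
    unfolding divide_inverse by (intro continuous_intros)
  moreover have "continuous_on A (\<lambda>p. snd p)"
    by (intro continuous_intros)
  ultimately show ?thesis
    by (cases "i = 0"; cases "i \<le> CARD('n)") (simp_all add: chain_def)
qed

lemma coord_cases:
  obtains i where "i \<in> {1..CARD('n)}" "a = (coord i :: 'n::{finite,linorder})"
  using bij_betw_coord[where 'n='n] unfolding bij_betw_def by blast

lemma ex_vec_coord:
  "\<exists>x :: 'a ^ 'n::{finite,linorder}. \<forall>i\<in>{1..CARD('n)}. x $ coord i = h i"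
proof
  let ?g = "the_inv_into {1..CARD('n)} (coord :: nat \<Rightarrow> 'n)"
  show "\<forall>i\<in>{1..CARD('n)}. (\<chi> a. h (?g a)) $ (coord i :: 'n) = h i"
    using bij_betw_coord[where 'n='n] by (auto simp: bij_betw_def the_inv_into_f_f)
qed

lemma chain_mono:
  fixes s :: "nat ^ 'n::{finite,linorder}"
  assumes "p \<in> chain_cone s" "i \<le> j" "j \<le> Suc CARD('n)"
  shows "chain s p i \<le> chain s p j"
  using assms(2,3)
proof (induction j rule: dec_induct)
  case (step m)
  then show ?case
    using assms(1) unfolding chain_cone_def by force
qed simp

lemma lecture_hall_polytope_iff:
  fixes s :: "nat ^ 'n::{finite,linorder}"
  shows "x \<in> lecture_hall_polytope s \<longleftrightarrow> (x, 1) \<in> chain_cone s"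
proof -
  \<comment> \<open>The definition of the polytope lists the first and the last of these
    inequalities separately.\<close>
  have "(\<forall>i\<le>CARD('n). Q i) \<longleftrightarrow> Q 0 \<and> (\<forall>i\<in>{1..<CARD('n)}. Q i) \<and> Q CARD('n)" for Q
    by (auto, metis One_nat_def Suc_leI atLeastLessThan_iff bot_nat_0.not_eq_extremum le_neq_implies_less)
  from this[of "\<lambda>i. chain s (x, 1) i \<le> chain s (x, 1) (Suc i)"] show ?thesis
    by (auto simp: lecture_hall_polytope_def chain_cone_def chain_def)
qed

lemma zero_in_chain_cone: "0 \<in> chain_cone s"
  by (simp add: chain_cone_def)

lemma convex_cone_chain_cone: "convex_cone (chain_cone s)"
  unfolding convex_cone_def convex_alt conic_def
proof (intro conjI)
  show "chain_cone s \<noteq> {}"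
    using zero_in_chain_cone by blast
qed (auto simp: chain_cone_def chain_add chain_scaleR intro!: add_mono mult_left_mono)

lemma int_points_diff: "p \<in> int_points \<Longrightarrow> q \<in> int_points \<Longrightarrow> p - q \<in> int_points"
  and int_points_add: "p \<in> int_points \<Longrightarrow> q \<in> int_points \<Longrightarrow> p + q \<in> int_points"
  by (auto simp: int_points_def)

section \<open>Facet description of the cone over the polytope and of its interior\<close>

context
  fixes s :: "nat ^ 'n::{finite,linorder}"
  assumes s_pos: "\<And>i. 0 < s $ i"
begin

lemma compact_lecture_hall_polytope: "compact (lecture_hall_polytope s)"
proof -
  have "chain_cone s = (\<Inter>i\<in>{..CARD('n)}. {p. chain s p i \<le> chain s p (Suc i)})"
    by (auto simp: chain_cone_def)
  then have "closed (chain_cone s)"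
    by (auto intro!: closed_INT closed_Collect_le continuous_intros)
  then have "closed ((\<lambda>x. (x, 1)) -` chain_cone s)"
    by (rule continuous_closed_vimage) (auto intro!: continuous_intros)
  moreover have "(\<lambda>x. (x, 1)) -` chain_cone s \<subseteq> cbox 0 (\<chi> a. real (s $ a))"
  proof (clarsimp simp: mem_box_cart)
    fix x :: "(real, 'n) vec" and a :: 'n
    assume x: "(x, 1) \<in> chain_cone s"
    obtain i where i: "i \<in> {1..CARD('n)}" "a = coord i"
      by (rule coord_cases)
    have "0 \<le> chain s (x, 1) i" "chain s (x, 1) i \<le> 1"
      using chain_mono[OF x, of 0 i] chain_mono[OF x, of i "Suc CARD('n)"] i
      by (auto simp: chain_def)
    then show "0 \<le> x $ a \<and> x $ a \<le> real (s $ a)"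
      using i s_pos[of a] by (auto simp: chain_def zero_le_divide_iff)
  qed
  ultimately have "compact ((\<lambda>x. (x, 1)) -` chain_cone s)"
    by (meson bounded_cbox bounded_subset compact_eq_bounded_closed)
  also have "(\<lambda>x. (x, 1)) -` chain_cone s = lecture_hall_polytope s"
    by (auto simp: lecture_hall_polytope_iff)
  finally show ?thesis .
qed

lemma convex_lecture_hall_polytope: "convex (lecture_hall_polytope s)"
proof (rule convexI)
  fix x y :: "(real, 'n) vec" and u v :: real
  assume "x \<in> lecture_hall_polytope s" "y \<in> lecture_hall_polytope s"
    and uv: "0 \<le> u" "0 \<le> v" "u + v = 1"
  then have "u *\<^sub>R (x, 1) + v *\<^sub>R (y, 1) \<in> chain_cone s"
    using convex_cone_chain_cone[of s] unfolding lecture_hall_polytope_iff convex_cone_def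
    by (meson convexD)
  then show "u *\<^sub>R x + v *\<^sub>R y \<in> lecture_hall_polytope s"
    using uv by (simp add: lecture_hall_polytope_iff)
qed

text \<open>By Krein-Milman the compact polytope is the convex hull of its extreme points, so a
  point of positive height, scaled to height one, lies in the hull of the lifted vertices. At height
  zero the chain runs from 0 to 0 and only the apex is left.\<close>

lemma polytope_cone_lecture_hall: "polytope_cone (lecture_hall_polytope s) = chain_cone s"
proof
  show "polytope_cone (lecture_hall_polytope s) \<subseteq> chain_cone s"
    unfolding polytope_cone_def
    by (rule hull_minimal)
       (auto simp: convex_cone_chain_cone extreme_point_of_def lecture_hall_polytope_iff)
next
  let ?E = "{v. v extreme_point_of lecture_hall_polytope s}"
  let ?f = "\<lambda>v :: (real, 'n) vec. (v, 1 :: real)"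
  \<comment> \<open>Lifting to height one is linear up to a translation, so it commutes with taking
    convex hulls.\<close>
  have f: "?f ` (convex hull ?E) = convex hull (?f ` ?E)"
  proof -
    have "?f ` A = (+) (0, 1) ` ((\<lambda>v. (v, 0)) ` A)" for A
      by (auto simp: image_image)
    moreover have "linear (\<lambda>v :: (real, 'n) vec. (v, 0 :: real))"
      by (auto intro!: linearI)
    ultimately show ?thesis
      by (simp add: convex_hull_translation convex_hull_linear_image)
  qed
  show "chain_cone s \<subseteq> polytope_cone (lecture_hall_polytope s)"
  proof
    fix p :: "(real, 'n) vec \<times> real"
    assume p: "p \<in> chain_cone s"
    have bounds: "0 \<le> chain s p i" "chain s p i \<le> snd p" if "i \<le> Suc CARD('n)" for i
      using chain_mono[OF p, of 0 i] chain_mono[OF p, of i "Suc CARD('n)"] that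
      by (auto simp: chain_def)
    show "p \<in> polytope_cone (lecture_hall_polytope s)"
    proof (cases "snd p = 0")
      case True
      have "fst p $ a = 0" for a
      proof -
        obtain i where i: "i \<in> {1..CARD('n)}" "a = coord i"
          by (rule coord_cases)
        then show ?thesis
          using bounds[of i] True s_pos[of a] by (auto simp: chain_def)
      qed
      then have "p = 0"
        using True by (simp add: prod_eq_iff vec_eq_iff)
      then show ?thesis
        by (simp add: polytope_cone_def convex_cone_hull_contains_0)
    next
      case False
      then have t: "0 < snd p"
        using bounds[of 0] by auto
      define q where "q = inverse (snd p) *\<^sub>R p"
      have "q \<in> chain_cone s"
        using p t by (auto simp: q_def chain_cone_def chain_scaleR)
      moreover have q: "q = ?f (fst q)"
        using t by (simp add: q_def prod_eq_iff)
      ultimately have "fst q \<in> lecture_hall_polytope s"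
        by (metis lecture_hall_polytope_iff)
      also have "lecture_hall_polytope s = convex hull ?E"
        by (rule Krein_Milman_Minkowski[OF compact_lecture_hall_polytope convex_lecture_hall_polytope])
      finally have "q \<in> convex hull (?f ` ?E)"
        using q f by blast
      then have "snd p *\<^sub>R q \<in> convex_cone hull (?f ` ?E)"
        using convex_hull_subset_convex_cone_hull t by (blast intro: convex_cone_hull_mul less_imp_le)
      then show ?thesis
        using t by (simp add: polytope_cone_def q_def)
    qed
  qed
qed

text \<open>Lattice points are built below by prescribing their chain;
  \<open>y i * real (s $ coord i)\<close> becomes the coordinate at \<open>coord i\<close>, whence
  the integrality conditions.\<close>

lemma ex_int_point:
  assumes "y 0 = 0" "y (Suc CARD('n)) \<in> \<int>"
    and "\<And>i. i \<in> {1..CARD('n)} \<Longrightarrow> y i * real (s $ coord i) \<in> \<int>"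
  obtains p where "p \<in> int_points" "\<And>i. i \<le> Suc CARD('n) \<Longrightarrow> chain s p i = y i"
proof -
  obtain x :: "(real, 'n) vec" where x: "\<forall>i\<in>{1..CARD('n)}. x $ coord i = y i * real (s $ coord i)"
    using ex_vec_coord[of "\<lambda>i. y i * real (s $ coord i)"] by blast
  have "(x, y (Suc CARD('n))) \<in> int_points"
    unfolding int_points_def
  proof (clarify, intro conjI allI)
    fix a :: 'n
    obtain i where "i \<in> {1..CARD('n)}" "a = coord i"
      by (rule coord_cases)
    then show "x $ a \<in> \<int>"
      using assms(3) x by simp
  qed (use assms(2) in simp)
  moreover have "chain s (x, y (Suc CARD('n))) i = y i" if "i \<le> Suc CARD('n)" for i
    using assms(1) x s_pos[of "coord i"] that by (auto simp: chain_def le_Suc_eq)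
  ultimately show thesis
    by (rule that)
qed

text \<open>The sum of all lifted vertices: every coefficient is one, so the point lies in the open
  cone.\<close>

lemma ex_one_point:
  obtains p where "p \<in> int_points" "\<And>i. i \<le> Suc CARD('n) \<Longrightarrow> chain s p i = real i"
  by (rule ex_int_point[of real]) auto

text \<open>The open cone is nonempty, so the relative interior is the interior. From an interior
  point a small multiple of \<open>w\<close> can be subtracted inside the cone; since each increment
  of \<open>w\<close> is one, every inequality had slack at least \<open>d\<close>.\<close>

lemma rel_interior_chain_cone: "rel_interior (chain_cone s) = chain_open_cone s"
proof -
  obtain w where w: "\<And>i. i \<le> Suc CARD('n) \<Longrightarrow> chain s w i = real i"
    using ex_one_point by blast
  have "chain_open_cone s = (\<Inter>i\<in>{..CARD('n)}. {p. chain s p i < chain s p (Suc i)})"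
    by (auto simp: chain_open_cone_def)
  then have "open (chain_open_cone s)"
    by (auto intro!: open_INT open_Collect_less continuous_intros)
  then have sub: "chain_open_cone s \<subseteq> interior (chain_cone s)"
    by (intro interior_maximal) (auto simp: chain_open_cone_def chain_cone_def less_imp_le)
  moreover have "interior (chain_cone s) \<subseteq> chain_open_cone s"
  proof
    fix p assume "p \<in> interior (chain_cone s)"
    then obtain e where e: "0 < e" "ball p e \<subseteq> chain_cone s"
      by (meson mem_interior)
    define d where "d = e / (2 * (norm w + 1))"
    have "0 < norm w + 1"
      by (simp add: add_nonneg_pos)
    then have d: "0 < d" "d * (2 * (norm w + 1)) = e"
      using e by (auto simp: d_def)
    moreover have "d * norm w < d * (2 * (norm w + 1))"
      using d(1) by (intro mult_strict_left_mono) (simp_all add: add_strict_increasing2)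
    ultimately have "d * norm w < e"
      by simp
    then have "p - d *\<^sub>R w \<in> chain_cone s"
      using d(1) by (intro subsetD[OF e(2)]) (simp add: dist_norm)
    then have "chain s p i - d * real i \<le> chain s p (Suc i) - d * real (Suc i)"
      if "i \<le> CARD('n)" for i
      using that w[of i] w[of "Suc i"] by (auto simp: chain_cone_def chain_diff chain_scaleR)
    then show "p \<in> chain_open_cone s"
      using d(1) by (force simp: chain_open_cone_def algebra_simps)
  qed
  moreover have "w \<in> chain_open_cone s"
    using w by (simp add: chain_open_cone_def)
  ultimately show ?thesis
    using rel_interior_nonempty_interior[of "chain_cone s"] by blast
qed

text \<open>Interior plus cone stays in the interior, so one inclusion only needs \<open>g\<close>
  to be interior, which the image of 0 forces. The other inclusion says that \<open>g\<close> is
  least among the interior lattice points in the order of the cone.\<close>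

lemma gorenstein_lecture_hall_iff:
  "gorenstein_polytope (lecture_hall_polytope s) \<longleftrightarrow>
    (\<exists>g\<in>int_points. g \<in> chain_open_cone s \<and>
      (\<forall>p\<in>int_points \<inter> chain_open_cone s. p - g \<in> chain_cone s))"
  (is "_ \<longleftrightarrow> (\<exists>g\<in>_. ?R g)")
proof -
  have "(+) g ` (chain_cone s \<inter> int_points) = chain_open_cone s \<inter> int_points \<longleftrightarrow> ?R g"
    if g: "g \<in> int_points" for g
  proof
    assume eq: "(+) g ` (chain_cone s \<inter> int_points) = chain_open_cone s \<inter> int_points"
    have "0 \<in> chain_cone s \<inter> int_points"
      using zero_in_chain_cone by (auto simp: int_points_def zero_prod_def)
    then have "g \<in> chain_open_cone s"
      using eq by (metis IntD1 add.right_neutral image_eqI)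
    moreover have "p - g \<in> chain_cone s" if "p \<in> int_points \<inter> chain_open_cone s" for p
    proof -
      have "p \<in> (+) g ` (chain_cone s \<inter> int_points)"
        using eq that by blast
      then show ?thesis
        by auto
    qed
    ultimately show "?R g"
      by blast
  next
    assume R: "?R g"
    show "(+) g ` (chain_cone s \<inter> int_points) = chain_open_cone s \<inter> int_points"
    proof (intro equalityI subsetI)
      fix p assume "p \<in> (+) g ` (chain_cone s \<inter> int_points)"
      then show "p \<in> chain_open_cone s \<inter> int_points"
        using R g by (force simp: chain_open_cone_def chain_cone_def chain_add
            intro: int_points_add add_less_le_mono)
    next
      fix p assume "p \<in> chain_open_cone s \<inter> int_points"
      then have "p - g \<in> chain_cone s \<inter> int_points"
        using R g by (auto intro: int_points_diff)
      then show "p \<in> (+) g ` (chain_cone s \<inter> int_points)"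
        by (metis add_diff_cancel_left' diff_add_cancel add.commute image_eqI)
    qed
  qed
  then show ?thesis
    by (auto simp: gorenstein_polytope_def polytope_cone_lecture_hall rel_interior_chain_cone)
qed


section \<open>Increments of inversion sequences\<close>

text \<open>Only classes modulo \<open>1\<close> matter, so the integer height at position \<open>n + 1\<close> is replaced by \<open>0\<close>.\<close>

definition ext_ratio :: "nat ^ 'n::{finite,linorder} \<Rightarrow> nat \<Rightarrow> real" where
  "ext_ratio e i = (if i \<le> CARD('n) then ratio s e i else 0)"

text \<open>
  Since the vertices generate the kernel of reduction modulo \<open>s\<close>, each class of lattice points modulo
  \<open>s\<close> has one representative in the half-open fundamental parallelepiped of the cone. These are the
  coefficients of the representative of \<open>-e\<close>; the sign makes its height count ascents.
\<close>

definition incr :: "nat ^ 'n::{finite,linorder} \<Rightarrow> nat \<Rightarrow> real" where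
  "incr e j = frac (ext_ratio e j - ext_ratio e (Suc j))"

lemma incr_nonneg: "0 \<le> incr e j"
  and incr_less_1: "incr e j < 1"
  by (simp_all add: incr_def frac_lt_1)

lemma ext_ratio_0 [simp]: "ext_ratio e 0 = 0"
  and ext_ratio_Suc_card [simp]: "ext_ratio e (Suc CARD('n)) = 0"
  by (simp_all add: ext_ratio_def ratio_def)

lemma ext_ratio_coord: "i \<in> {1..CARD('n)} \<Longrightarrow> ext_ratio e i = real (e $ coord i) / real (s $ coord i)"
  by (simp add: ext_ratio_def ratio_def)

lemma ext_ratio_bounds:
  assumes "e \<in> inv_seqs s"
  shows "0 \<le> ext_ratio e i" "ext_ratio e i < 1"
  using assms by (auto simp: ext_ratio_def ratio_def inv_seqs_def s_pos)

text \<open>Both quotients lie in [0, 1), so \<open>frac\<close> corrects their difference by one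
  exactly at an ascent.\<close>

lemma incr_eq:
  assumes "e \<in> inv_seqs s"
  shows "incr e j = ext_ratio e j - ext_ratio e (Suc j)
    + (if ext_ratio e j < ext_ratio e (Suc j) then 1 else 0)"
  using ext_ratio_bounds[OF assms, of j] ext_ratio_bounds[OF assms, of "Suc j"]
  by (auto simp: incr_def frac_unique_iff)

text \<open>The differences telescope from 0 to 0, which leaves one unit per ascent.\<close>

lemma sum_incr:
  assumes "e \<in> inv_seqs s"
  shows "(\<Sum>j\<le>CARD('n). incr e j) = real (asc s e)"
proof -
  have "(\<Sum>j\<le>CARD('n). incr e j) = (\<Sum>j\<le>CARD('n). ext_ratio e j - ext_ratio e (Suc j))
      + real (card {j \<in> {..CARD('n)}. ext_ratio e j < ext_ratio e (Suc j)})"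
    by (simp add: incr_eq[OF assms] sum.distrib sum.If_cases Int_def)
  also have "(\<Sum>j\<le>CARD('n). ext_ratio e j - ext_ratio e (Suc j)) = 0"
    by (simp add: sum_telescope)
  also have "{j \<in> {..CARD('n)}. ext_ratio e j < ext_ratio e (Suc j)} = Asc s e"
  proof (intro set_eqI)
    fix j
    consider "j < CARD('n)" | "j = CARD('n)" | "CARD('n) < j"
      by linarith
    then show "j \<in> {j \<in> {..CARD('n)}. ext_ratio e j < ext_ratio e (Suc j)} \<longleftrightarrow> j \<in> Asc s e"
    proof cases
      \<comment> \<open>The index \<open>CARD('n)\<close>, absent from \<open>Asc\<close>, is no
        ascent because the next value of \<open>ext_ratio\<close> is 0.\<close>
      case 2
      then show ?thesis
        using ext_ratio_bounds(1)[OF assms, of j] by (simp add: Asc_def)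
    qed (simp_all add: Asc_def ext_ratio_def)
  qed
  finally show ?thesis
    by (simp add: asc_def)
qed

text \<open>Modulo 1 each increment is the difference it comes from, so the partial sums telescope
  to \<open>- ext_ratio e i\<close>.\<close>

lemma sum_incr_add_ext_ratio_Ints:
  assumes "i \<le> Suc CARD('n)"
  shows "(\<Sum>j<i. incr e j) + ext_ratio e i \<in> \<int>"
  using assms
proof (induction i)
  case (Suc i)
  have "(\<Sum>j<Suc i. incr e j) + ext_ratio e (Suc i)
      = ((\<Sum>j<i. incr e j) + ext_ratio e i) - of_int \<lfloor>ext_ratio e i - ext_ratio e (Suc i)\<rfloor>"
    by (simp add: incr_def frac_def)
  moreover have "\<dots> \<in> \<int>"
    using Suc by (intro Ints_diff Ints_of_int) simp
  ultimately show ?case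
    by (simp only:)
qed simp

text \<open>Builds an inversion sequence from a chain taken modulo 1: reducing
  \<open>y i * real (s $ coord i)\<close> modulo \<open>s $ coord i\<close> changes
  \<open>y i\<close> by an integer, which \<open>frac\<close> does not see.\<close>

lemma ex_residue:
  assumes "y 0 \<in> \<int>" "y (Suc CARD('n)) \<in> \<int>"
    and "\<And>i. i \<in> {1..CARD('n)} \<Longrightarrow> y i * real (s $ coord i) \<in> \<int>"
  obtains e where "e \<in> inv_seqs s"
    "\<And>j. j \<le> CARD('n) \<Longrightarrow> incr e j = frac (y j - y (Suc j))"
proof -
  \<comment> \<open>The floor only casts, since the product is an integer.\<close>
  obtain e :: "(nat, 'n) vec" where e: "\<forall>i\<in>{1..CARD('n)}.
      e $ coord i = nat (\<lfloor>y i * real (s $ coord i)\<rfloor> mod int (s $ coord i))"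
    using ex_vec_coord[of "\<lambda>i. nat (\<lfloor>y i * real (s $ coord i)\<rfloor> mod int (s $ coord i))"]
    by blast
  have "e \<in> inv_seqs s"
    unfolding inv_seqs_def
  proof (clarify)
    fix a :: 'n
    obtain i where "i \<in> {1..CARD('n)}" "a = coord i"
      by (rule coord_cases)
    then show "e $ a < s $ a"
      using e s_pos[of a] by (simp add: nat_less_iff)
  qed
  moreover have diff: "y i - ext_ratio e i \<in> \<int>" if "i \<le> Suc CARD('n)" for i
  proof (cases "i \<in> {1..CARD('n)}")
    case True
    define m where "m = int (s $ coord i)"
    obtain k where k: "y i * real (s $ coord i) = of_int k"
      using assms(3)[OF True] by (auto elim: Ints_cases)
    have m: "0 < m"
      using s_pos by (simp add: m_def)
    have "ext_ratio e i = of_int (k mod m) / of_int m"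
      using True e k m by (simp add: ext_ratio_coord m_def)
    moreover have "y i = of_int k / of_int m"
      using k s_pos[of "coord i"] by (simp add: m_def field_simps)
    moreover have "real_of_int k - of_int (k mod m) = of_int m * of_int (k div m)"
      by (metis add_diff_cancel_right' mult_div_mod_eq of_int_add of_int_mult)
    ultimately have "y i - ext_ratio e i = of_int (k div m)"
      using m by (simp flip: diff_divide_distrib)
    then show ?thesis
      by simp
  next
    case False
    then show ?thesis
      using assms(1,2) that by (auto simp: le_Suc_eq not_less_eq_eq)
  qed
  moreover have "incr e j = frac (y j - y (Suc j))" if "j \<le> CARD('n)" for j
  proof -
    have "(y j - ext_ratio e j) - (y (Suc j) - ext_ratio e (Suc j)) \<in> \<int>"
      using that by (intro Ints_diff diff) auto
    then have "frac (y j - y (Suc j)) = frac (ext_ratio e j - ext_ratio e (Suc j)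
        + ((y j - ext_ratio e j) - (y (Suc j) - ext_ratio e (Suc j))))"
      by (simp add: algebra_simps)
    also have "\<dots> = incr e j"
      unfolding incr_def by (rule frac_add_int_right) fact
    finally show ?thesis ..
  qed
  ultimately show thesis
    using that by blast
qed

text \<open>Reduction modulo \<open>s $ coord i\<close> shifts the quotient by an integer, so
  increments are additive modulo 1.\<close>

lemma incr_inv_add:
  assumes "j \<le> CARD('n)"
  shows "incr (inv_add s e e') j = frac (incr e j + incr e' j)"
proof -
  let ?f = "inv_add s e e'"
  have diff: "ext_ratio ?f i - ext_ratio e i - ext_ratio e' i \<in> \<int>" if "i \<le> Suc CARD('n)" for i
  proof (cases "i \<in> {1..CARD('n)}")
    case True
    define m where "m = s $ coord i"
    define k where "k = e $ coord i + e' $ coord i"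
    have "0 < m"
      using s_pos by (simp add: m_def)
    have "real k = real m * real (k div m) + real (k mod m)"
      by (metis mult_div_mod_eq of_nat_add of_nat_mult)
    then have "real (k mod m) / real m - real k / real m = - real (k div m)"
      using \<open>0 < m\<close> by (simp add: field_simps)
    then have "ext_ratio ?f i - ext_ratio e i - ext_ratio e' i = - real (k div m)"
      using True by (simp add: ext_ratio_coord inv_add_def k_def m_def add_divide_distrib)
    then show ?thesis
      by simp
  qed (use that in \<open>auto simp: le_Suc_eq not_less_eq_eq\<close>)
  let ?c = "\<lambda>i. ext_ratio ?f i - ext_ratio e i - ext_ratio e' i"
  have "?c j - ?c (Suc j) \<in> \<int>"
    using assms by (intro Ints_diff diff) auto
  then have "incr ?f j = frac ((ext_ratio e j - ext_ratio e (Suc j))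
      + (ext_ratio e' j - ext_ratio e' (Suc j)))"
    unfolding incr_def
    by (subst frac_add_int_right[symmetric, of "?c j - ?c (Suc j)"]) (auto simp: algebra_simps)
  then show ?thesis
    by (simp add: incr_def)
qed

lemma inv_add_in_inv_seqs: "inv_add s e e' \<in> inv_seqs s"
  by (simp add: inv_add_def inv_seqs_def s_pos)

text \<open>Partial sums of increments determine \<open>ext_ratio\<close> modulo 1, hence exactly,
  as its values lie in [0, 1).\<close>

lemma incr_inject:
  assumes e: "e \<in> inv_seqs s" "e' \<in> inv_seqs s"
    and eq: "\<And>j. j \<le> CARD('n) \<Longrightarrow> incr e j = incr e' j"
  shows "e = e'"
proof -
  have ratio: "ext_ratio e i = ext_ratio e' i" if "i \<le> Suc CARD('n)" for i
  proof -
    have "(\<Sum>j<i. incr e j) = (\<Sum>j<i. incr e' j)"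
      using that by (intro sum.cong) (auto intro: eq)
    then have "ext_ratio e i - ext_ratio e' i \<in> \<int>"
      using Ints_diff[OF sum_incr_add_ext_ratio_Ints[OF that, of e]
          sum_incr_add_ext_ratio_Ints[OF that, of e']] by simp
    then have "frac (ext_ratio e i) = ext_ratio e' i"
      using ext_ratio_bounds[OF e(2), of i] by (simp add: frac_unique_iff)
    then show ?thesis
      using ext_ratio_bounds[OF e(1), of i] by (simp add: frac_eq)
  qed
  have "e $ a = e' $ a" for a
  proof -
    obtain i where "i \<in> {1..CARD('n)}" "a = coord i"
      by (rule coord_cases)
    then show ?thesis
      using ratio[of i] s_pos[of a] by (simp add: ext_ratio_coord)
  qed
  then show ?thesis
    by (simp add: vec_eq_iff)
qed

text \<open>The all-ones vector minus the coefficients of the representative of \<open>-e\<close>: a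
  point in the class of \<open>e\<close> itself, interior because all its coefficients lie in (0,
  1].\<close>

lemma int_point_of_incr:
  obtains p where "p \<in> int_points"
    "\<And>j. j \<le> CARD('n) \<Longrightarrow> chain s p (Suc j) - chain s p j = 1 - incr e j"
proof -
  define y where "y i = real i - (\<Sum>j<i. incr e j)" for i
  have yE: "y i - ext_ratio e i \<in> \<int>" if "i \<le> Suc CARD('n)" for i
    using Ints_diff[OF Ints_of_nat[of i] sum_incr_add_ext_ratio_Ints[OF that, of e]]
    by (simp add: y_def algebra_simps)
  obtain p where p: "p \<in> int_points" "\<And>i. i \<le> Suc CARD('n) \<Longrightarrow> chain s p i = y i"
  proof (rule ex_int_point[of y])
    show "y (Suc CARD('n)) \<in> \<int>"
      using yE[of "Suc CARD('n)"] by simp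
    fix i assume i: "i \<in> {1..CARD('n)}"
    have "ext_ratio e i * real (s $ coord i) = real (e $ coord i)"
      using i s_pos[of "coord i"] by (simp add: ext_ratio_coord)
    then have "y i * real (s $ coord i)
        = (y i - ext_ratio e i) * real (s $ coord i) + real (e $ coord i)"
      by (simp add: algebra_simps)
    moreover have "(y i - ext_ratio e i) * real (s $ coord i) + real (e $ coord i) \<in> \<int>"
      using i by (intro Ints_add Ints_mult yE Ints_of_nat) auto
    ultimately show "y i * real (s $ coord i) \<in> \<int>"
      by simp
  qed (auto simp: y_def)
  show thesis
    by (rule that[OF p(1)]) (simp add: p(2) y_def)
qed

text \<open>Sends a lattice point to its class; the coefficients appear negated because
  \<open>incr\<close> describes \<open>-e\<close>.\<close>

lemma residue_of_int_point:
  assumes "p \<in> int_points"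
  obtains e where "e \<in> inv_seqs s"
    "\<And>j. j \<le> CARD('n) \<Longrightarrow> incr e j = frac (chain s p j - chain s p (Suc j))"
proof (rule ex_residue[of "chain s p"])
  fix i assume "i \<in> {1..CARD('n)}"
  then show "chain s p i * real (s $ coord i) \<in> \<int>"
    using assms s_pos[of "coord i"] by (auto simp: chain_def int_points_def)
qed (use assms in \<open>auto simp: chain_def int_points_def\<close>)

text \<open>The least positive coefficient available in the class of \<open>e\<close> is
  \<open>1 - incr e j\<close>. So an interior lattice point least in every coefficient corresponds
  to an \<open>m\<close> greatest in every increment.\<close>

lemma gorenstein_iff_dominating:
  "gorenstein_polytope (lecture_hall_polytope s) \<longleftrightarrow>
    (\<exists>m\<in>inv_seqs s. \<forall>e\<in>inv_seqs s. \<forall>j\<le>CARD('n). incr e j \<le> incr m j)"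
  unfolding gorenstein_lecture_hall_iff
proof
  assume "\<exists>g\<in>int_points. g \<in> chain_open_cone s \<and>
      (\<forall>p\<in>int_points \<inter> chain_open_cone s. p - g \<in> chain_cone s)"
  then obtain g where g: "g \<in> int_points" "g \<in> chain_open_cone s"
    and min: "\<And>p. p \<in> int_points \<Longrightarrow> p \<in> chain_open_cone s \<Longrightarrow> p - g \<in> chain_cone s"
    by blast
  let ?d = "\<lambda>p j. chain s p (Suc j) - chain s p j"
  have d_min: "?d g j \<le> ?d p j"
    if "p \<in> int_points" "p \<in> chain_open_cone s" "j \<le> CARD('n)" for p j
    using min[OF that(1,2)] that(3) by (auto simp: chain_cone_def chain_diff algebra_simps)
  obtain m where m: "m \<in> inv_seqs s" "\<And>j. j \<le> CARD('n) \<Longrightarrow> incr m j = frac (- ?d g j)"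
    using residue_of_int_point[OF g(1)] by (metis minus_diff_eq)
  obtain w where w: "w \<in> int_points" "\<And>i. i \<le> Suc CARD('n) \<Longrightarrow> chain s w i = real i"
    using ex_one_point by blast
  have "w \<in> chain_open_cone s"
    using w by (simp add: chain_open_cone_def)
  \<comment> \<open>Comparison with the all-ones point puts the coefficients of \<open>g\<close> in
    (0, 1], where \<open>frac (- d)\<close> is \<open>1 - d\<close>.\<close>
  then have "?d g j \<le> 1" if "j \<le> CARD('n)" for j
    using d_min[OF w(1) _ that] w(2) that by simp
  moreover have "0 < ?d g j" if "j \<le> CARD('n)" for j
    using g(2) that by (simp add: chain_open_cone_def)
  ultimately have m_eq: "incr m j = 1 - ?d g j" if "j \<le> CARD('n)" for j
    using m(2)[OF that] that by (simp add: frac_unique_iff)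
  have "incr e j \<le> incr m j" if "j \<le> CARD('n)" for e j
  proof -
    obtain p where p: "p \<in> int_points" "\<And>j. j \<le> CARD('n) \<Longrightarrow> ?d p j = 1 - incr e j"
      using int_point_of_incr[of e] by blast
    have "p \<in> chain_open_cone s"
      unfolding chain_open_cone_def
    proof (clarify)
      fix i assume "i \<le> CARD('n)"
      then show "chain s p i < chain s p (Suc i)"
        using p(2)[of i] incr_less_1[of e i] by simp
    qed
    then show ?thesis
      using d_min[OF p(1) _ that] p(2)[OF that] m_eq[OF that] by simp
  qed
  then show "\<exists>m\<in>inv_seqs s. \<forall>e\<in>inv_seqs s. \<forall>j\<le>CARD('n). incr e j \<le> incr m j"
    using m(1) by blast
next
  assume "\<exists>m\<in>inv_seqs s. \<forall>e\<in>inv_seqs s. \<forall>j\<le>CARD('n). incr e j \<le> incr m j"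
  then obtain m where m: "\<And>e j. e \<in> inv_seqs s \<Longrightarrow> j \<le> CARD('n) \<Longrightarrow> incr e j \<le> incr m j"
    by blast
  obtain g where g: "g \<in> int_points"
    "\<And>j. j \<le> CARD('n) \<Longrightarrow> chain s g (Suc j) - chain s g j = 1 - incr m j"
    using int_point_of_incr[of m] by blast
  have "g \<in> chain_open_cone s"
    unfolding chain_open_cone_def
  proof (clarify)
    fix i assume "i \<le> CARD('n)"
    then show "chain s g i < chain s g (Suc i)"
      using g(2)[of i] incr_less_1[of m i] by simp
  qed
  moreover have "p - g \<in> chain_cone s" if p: "p \<in> int_points \<inter> chain_open_cone s" for p
    unfolding chain_cone_def
  proof (clarify)
    fix j assume j: "j \<le> CARD('n)"
    obtain e where e: "e \<in> inv_seqs s"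
      "\<And>j. j \<le> CARD('n) \<Longrightarrow> incr e j = frac (chain s p j - chain s p (Suc j))"
      using residue_of_int_point p by blast
    \<comment> \<open>A negative number has floor at most -1, so a positive coefficient is at least
      \<open>1 - incr e j\<close>.\<close>
    have "chain s p j - chain s p (Suc j) < 0"
      using p j by (simp add: chain_open_cone_def)
    then have "\<lfloor>chain s p j - chain s p (Suc j)\<rfloor> < 0"
      by simp
    then have "real_of_int \<lfloor>chain s p j - chain s p (Suc j)\<rfloor> \<le> - 1"
      by linarith
    then have "1 - incr e j \<le> chain s p (Suc j) - chain s p j"
      by (simp add: e(2)[OF j] frac_def)
    then show "chain s (p - g) j \<le> chain s (p - g) (Suc j)"
      using m[OF e(1) j] g(2)[OF j] by (simp add: chain_diff)
  qed
  ultimately show "\<exists>g\<in>int_points. g \<in> chain_open_cone s \<and>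
      (\<forall>p\<in>int_points \<inter> chain_open_cone s. p - g \<in> chain_cone s)"
    using g(1) by blast
qed


section \<open>Splitting off an element with one ascent\<close>

text \<open>
  The integer decomposition property: a lattice point \<open>(x, t)\<close> of the cone with \<open>t \<ge> 1\<close> splits as
  \<open>(min x s, 1)\<close> plus \<open>(max (x - s) 0, t - 1)\<close>, both of which lie in the cone.
\<close>

lemma ex_asc_1_below:
  assumes f: "f \<in> inv_seqs s" and "1 \<le> asc s f"
  obtains e where "e \<in> inv_seqs_asc s 1" "\<And>j. j \<le> CARD('n) \<Longrightarrow> incr e j \<le> incr f j"
proof -
  define X where "X i = (\<Sum>j<i. incr f j)" for i
  \<comment> \<open>The chain of \<open>(min x s, 1)\<close>. Truncation is monotone and does not
    stretch distances, so its increments lie between 0 and those of \<open>f\<close>.\<close>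
  define Q where "Q i = min (X i) 1" for i
  have X_Suc: "X (Suc j) = X j + incr f j" for j
    by (simp add: X_def)
  have X_top: "X (Suc CARD('n)) = real (asc s f)"
    by (simp add: X_def lessThan_Suc_atMost sum_incr[OF f])
  have X_nonneg: "0 \<le> X i" for i
    by (simp add: X_def sum_nonneg incr_nonneg)
  have Q_step: "0 \<le> Q (Suc j) - Q j" "Q (Suc j) - Q j \<le> incr f j" for j
    using incr_nonneg[of f j] by (auto simp: Q_def X_Suc)
  have Q_0: "Q 0 = 0" and Q_top: "Q (Suc CARD('n)) = 1"
    using assms(2) X_top by (auto simp: Q_def X_def)
  have Q_Ints: "- Q i * real (s $ coord i) \<in> \<int>" if i: "i \<in> {1..CARD('n)}" for i
  proof -
    have "ext_ratio f i * real (s $ coord i) = real (f $ coord i)"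
      using i s_pos[of "coord i"] by (simp add: ext_ratio_coord)
    then have "X i * real (s $ coord i)
        = (X i + ext_ratio f i) * real (s $ coord i) - real (f $ coord i)"
      by (simp add: algebra_simps)
    moreover have "(X i + ext_ratio f i) * real (s $ coord i) - real (f $ coord i) \<in> \<int>"
      unfolding X_def using i
      by (intro Ints_diff Ints_mult sum_incr_add_ext_ratio_Ints Ints_of_nat) auto
    ultimately have "X i * real (s $ coord i) \<in> \<int>"
      by simp
    then show ?thesis
      by (auto simp: Q_def min_def)
  qed
  \<comment> \<open>The sign in \<open>- Q i\<close> matches the convention that
    \<open>incr e\<close> represents \<open>-e\<close>.\<close>
  obtain e where e: "e \<in> inv_seqs s"
    "\<And>j. j \<le> CARD('n) \<Longrightarrow> incr e j = frac (Q (Suc j) - Q j)"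
    by (rule ex_residue[of "\<lambda>i. - Q i"]) (use Q_0 Q_top Q_Ints in auto)
  have incr_e: "incr e j = Q (Suc j) - Q j" if "j \<le> CARD('n)" for j
    using Q_step[of j] incr_less_1[of f j] by (simp add: e(2)[OF that] frac_eq)
  have "real (asc s e) = (\<Sum>j\<le>CARD('n). Q (Suc j) - Q j)"
    by (simp add: incr_e flip: sum_incr[OF e(1)])
  also have "\<dots> = 1"
    using sum_lessThan_telescope[of Q "Suc CARD('n)"] Q_0 Q_top by (simp add: lessThan_Suc_atMost)
  finally have "e \<in> inv_seqs_asc s 1"
    using e(1) by (simp add: inv_seqs_asc_def)
  then show thesis
    using that incr_e Q_step(2) by fastforce
qed

lemma incr_inv_add_le:
  assumes "j \<le> CARD('n)"
  shows "incr (inv_add s e e') j \<le> incr e j + incr e' j"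
  using incr_nonneg[of e j] incr_nonneg[of e' j]
  by (simp add: incr_inv_add[OF assms] frac_def)

text \<open>Ascents add up exactly when no carry occurs in any coefficient.\<close>

lemma incr_inv_add_of_asc:
  assumes "e \<in> inv_seqs s" "e' \<in> inv_seqs s"
    and "asc s (inv_add s e e') = asc s e + asc s e'" "j \<le> CARD('n)"
  shows "incr (inv_add s e e') j = incr e j + incr e' j"
proof -
  have "(\<Sum>j\<le>CARD('n). incr (inv_add s e e') j) = (\<Sum>j\<le>CARD('n). incr e j + incr e' j)"
    using assms(1-3) by (simp add: sum_incr inv_add_in_inv_seqs sum.distrib)
  then show ?thesis
    by (rule sum_mono_inv) (use assms(4) in \<open>auto intro: incr_inv_add_le\<close>)
qed

section \<open>Domination of increments and numbers of ascents\<close>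

lemma asc_mono:
  assumes "e \<in> inv_seqs s" "m \<in> inv_seqs s" "\<And>j. j \<le> CARD('n) \<Longrightarrow> incr e j \<le> incr m j"
  shows "asc s e \<le> asc s m"
proof -
  have "real (asc s e) \<le> real (asc s m)"
    unfolding sum_incr[OF assms(1), symmetric] sum_incr[OF assms(2), symmetric]
    by (rule sum_mono) (use assms(3) in auto)
  then show ?thesis
    by simp
qed

text \<open>Termwise comparable families with the same sum agree, and increments determine the
  sequence.\<close>

lemma eq_dominating:
  assumes "e \<in> inv_seqs s" "m \<in> inv_seqs s" "\<And>j. j \<le> CARD('n) \<Longrightarrow> incr e j \<le> incr m j"
    and "asc s e = asc s m"
  shows "e = m"
proof (rule incr_inject)
  fix j assume "j \<le> CARD('n)"
  have "(\<Sum>j\<le>CARD('n). incr e j) = (\<Sum>j\<le>CARD('n). incr m j)"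
    using assms by (simp add: sum_incr)
  then show "incr e j = incr m j"
    by (rule sum_mono_inv) (use assms(3) \<open>j \<le> CARD('n)\<close> in auto)
qed fact+

text \<open>The difference \<open>f\<close> of \<open>m\<close> and \<open>e\<close> has at least
  one ascent. An element with one ascent below \<open>f\<close> can be added to \<open>e\<close>
  without carry, because the sums of increments stay below \<open>incr m j < 1\<close>.\<close>

lemma ex_asc_Suc_of_dominating:
  assumes e: "e \<in> inv_seqs s" and m: "m \<in> inv_seqs s"
    and le: "\<And>j. j \<le> CARD('n) \<Longrightarrow> incr e j \<le> incr m j"
    and less: "asc s e < asc s m"
  obtains e' where "e' \<in> inv_seqs_asc s 1" "asc s (inv_add s e e') = asc s e + 1"
proof -
  obtain f where f: "f \<in> inv_seqs s" "\<And>j. j \<le> CARD('n) \<Longrightarrow> incr f j = incr m j - incr e j"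
  proof -
    \<comment> \<open>The class of \<open>m - e\<close>; domination keeps the differences of
      increments in [0, 1), where \<open>frac\<close> is the identity.\<close>
    let ?y = "\<lambda>i. ext_ratio m i - ext_ratio e i"
    have "?y i * real (s $ coord i) \<in> \<int>" if "i \<in> {1..CARD('n)}" for i
      using that s_pos[of "coord i"] by (simp add: ext_ratio_coord algebra_simps)
    then obtain f where f: "f \<in> inv_seqs s"
      "\<And>j. j \<le> CARD('n) \<Longrightarrow> incr f j = frac (?y j - ?y (Suc j))"
      by (rule ex_residue[rotated 2]) auto
    have "incr f j = incr m j - incr e j" if "j \<le> CARD('n)" for j
      using frac_diff_pos[OF le[OF that, unfolded incr_def]] f(2)[OF that]
      by (simp add: incr_def algebra_simps)
    then show thesis
      using f(1) that by blast
  qed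
  have "real (asc s f) = real (asc s m) - real (asc s e)"
    using f e m by (simp add: sum_subtractf flip: sum_incr)
  then have "1 \<le> asc s f"
    using less by linarith
  then obtain e' where e': "e' \<in> inv_seqs_asc s 1" "\<And>j. j \<le> CARD('n) \<Longrightarrow> incr e' j \<le> incr f j"
    using ex_asc_1_below[OF f(1)] by blast
  have e'_in: "e' \<in> inv_seqs s" "asc s e' = 1"
    using e'(1) by (auto simp: inv_seqs_asc_def)
  have "incr (inv_add s e e') j = incr e j + incr e' j" if "j \<le> CARD('n)" for j
    using e'(2)[OF that] f(2)[OF that] incr_less_1[of m j] incr_nonneg[of e j] incr_nonneg[of e' j]
    by (simp add: incr_inv_add[OF that] frac_eq)
  then have "real (asc s (inv_add s e e')) = real (asc s e) + real (asc s e')"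
    using e e'_in(1) by (simp add: inv_add_in_inv_seqs sum.distrib flip: sum_incr)
  then show thesis
    using that e'(1) e'_in(2) by simp
qed

lemma asc_le_Max:
  assumes "e \<in> inv_seqs s"
  shows "asc s e \<le> Max (asc s ` inv_seqs s)"
proof (rule Max_ge)
  have "asc s e \<le> card {0..<CARD('n)}" for e
    unfolding asc_def by (rule card_mono) (auto simp: Asc_def)
  then show "finite (asc s ` inv_seqs s)"
    by (intro finite_subset[OF _ finite_atMost[of "CARD('n)"]]) auto
qed (use assms in simp)

text \<open>Induction on the distance to \<open>r\<close>. Without ascents all increments vanish,
  and with \<open>r\<close> ascents the element is \<open>m\<close>. Otherwise a climbing step adds
  ascents without carry, so no increment decreases on the way up to \<open>m\<close>.\<close>

lemma incr_le_of_climb: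
  assumes r: "\<And>e. e \<in> inv_seqs s \<Longrightarrow> asc s e \<le> r"
    and climb: "\<And>e. e \<in> inv_seqs s \<Longrightarrow> 1 \<le> asc s e \<Longrightarrow> asc s e < r \<Longrightarrow>
      \<exists>e'\<in>inv_seqs_asc s 1. inv_add s e e' \<in> inv_seqs_asc s (asc s e + 1)"
    and top: "inv_seqs_asc s r = {m}"
    and "e \<in> inv_seqs s" "j \<le> CARD('n)"
  shows "incr e j \<le> incr m j"
  using \<open>e \<in> inv_seqs s\<close>
proof (induction "r - asc s e" arbitrary: e rule: less_induct)
  case less
  consider "asc s e = 0" | "asc s e = r" | "1 \<le> asc s e" "asc s e < r"
    using r[OF less.prems] by linarith
  then show ?case
  proof cases
    case 1
    then have "(\<Sum>j\<le>CARD('n). incr e j) = 0"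
      by (simp add: sum_incr[OF less.prems])
    then have "incr e j = 0"
      using \<open>j \<le> CARD('n)\<close> by (simp add: sum_nonneg_eq_0_iff incr_nonneg)
    then show ?thesis
      by (simp add: incr_nonneg)
  next
    case 2
    then have "e \<in> inv_seqs_asc s r"
      using less.prems by (simp add: inv_seqs_asc_def)
    then show ?thesis
      using top by simp
  next
    case 3
    then obtain e' where e': "e' \<in> inv_seqs s" "asc s e' = 1"
      "asc s (inv_add s e e') = asc s e + 1"
      using climb[OF less.prems] by (auto simp: inv_seqs_asc_def)
    have "incr e j \<le> incr e j + incr e' j"
      by (simp add: incr_nonneg)
    also have "\<dots> = incr (inv_add s e e') j"
      using incr_inv_add_of_asc[OF less.prems e'(1) _ \<open>j \<le> CARD('n)\<close>] e'(2,3) by simp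
    also have "\<dots> \<le> incr m j"
      using less.hyps[of "inv_add s e e'"] 3 e'(3) by (simp add: inv_add_in_inv_seqs)
    finally show ?thesis .
  qed
qed

end

section \<open>Domination is equivalent to conditions (1) and (2)\<close>

theorem corollary21:
  fixes s :: "nat ^ 'n::{finite,linorder}" and r :: nat
  assumes "\<forall>i. s $ i \<ge> 1"
    and "r = Max (asc s ` inv_seqs s)"
  shows "gorenstein_polytope (lecture_hall_polytope s) \<longleftrightarrow>
    (\<forall>k e. 1 \<le> k \<and> k < r \<and> e \<in> inv_seqs_asc s k \<longrightarrow>
       (\<exists>e' \<in> inv_seqs_asc s 1. inv_add s e e' \<in> inv_seqs_asc s (k + 1))) \<and>
    card (inv_seqs_asc s r) = 1"
    (is "_ \<longleftrightarrow> ?climb \<and> ?unique")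
proof -
  have s: "\<And>i. 0 < s $ i"
    using assms(1) by (simp add: Suc_le_eq)
  have le_r: "asc s e \<le> r" if "e \<in> inv_seqs s" for e
    using asc_le_Max[OF s that] assms(2) by simp
  have "(\<exists>m\<in>inv_seqs s. \<forall>e\<in>inv_seqs s. \<forall>j\<le>CARD('n). incr s e j \<le> incr s m j) \<longleftrightarrow>
    ?climb \<and> ?unique" (is "?dom \<longleftrightarrow> _")
  proof
    assume ?dom
    then obtain m where m: "m \<in> inv_seqs s"
      and le: "\<And>e j. e \<in> inv_seqs s \<Longrightarrow> j \<le> CARD('n) \<Longrightarrow> incr s e j \<le> incr s m j"
      by blast
    \<comment> \<open>A dominating element has the most ascents, as \<open>asc\<close> is the sum of
      the increments.\<close>
    have r: "r = asc s m"
      unfolding assms(2) using m asc_mono[OF s _ m le]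
      by (intro Max_eqI) (auto intro: finite_subset[of _ "{..asc s m}"])
    have ?climb
    proof (intro allI impI)
      fix k e assume "1 \<le> k \<and> k < r \<and> e \<in> inv_seqs_asc s k"
      then have e: "e \<in> inv_seqs s" "asc s e = k" "asc s e < asc s m"
        using r by (auto simp: inv_seqs_asc_def)
      obtain e' where "e' \<in> inv_seqs_asc s 1" "asc s (inv_add s e e') = asc s e + 1"
        using ex_asc_Suc_of_dominating[OF s e(1) m le[OF e(1)] e(3)] by blast
      then show "\<exists>e'\<in>inv_seqs_asc s 1. inv_add s e e' \<in> inv_seqs_asc s (k + 1)"
        using e(2) inv_add_in_inv_seqs[OF s] by (auto simp: inv_seqs_asc_def)
    qed
    moreover have "inv_seqs_asc s r = {m}"
      using eq_dominating[OF s _ m le] m r by (auto simp: inv_seqs_asc_def)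
    ultimately show "?climb \<and> ?unique"
      by simp
  next
    assume R: "?climb \<and> ?unique"
    then obtain m where top: "inv_seqs_asc s r = {m}"
      by (auto simp: card_1_singleton_iff)
    have "incr s e j \<le> incr s m j" if "e \<in> inv_seqs s" "j \<le> CARD('n)" for e j
    proof (rule incr_le_of_climb[OF s le_r _ top that])
      fix e assume "e \<in> inv_seqs s" "1 \<le> asc s e" "asc s e < r"
      then show "\<exists>e'\<in>inv_seqs_asc s 1. inv_add s e e' \<in> inv_seqs_asc s (asc s e + 1)"
        using R by (auto simp: inv_seqs_asc_def)
    qed
    moreover have "m \<in> inv_seqs s"
      using top by (auto simp: inv_seqs_asc_def)
    ultimately show ?dom
      by blast
  qed
  then show ?thesis
    by (simp add: gorenstein_iff_dominating[OF s])
qed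

end
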